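(* Let $(F,W,P,\boldsymbol{q})$ be a many-to-one matching market (with strict preferences, and $\boldsymbol{q}$-responsive preferences for firms). Each strongly stable fractional matching $\bar x$ fulfils the following two conditions: 1. Each worker has positive probability with at most two distinct firms: for every $w\in W$, $|\{f\in F:\bar x_{f,w}>0\}|\le 2$. 2. For each firm, all but possibly one position are assigned deterministically, and for the one position that is assigned by a lottery, two workers have a positive probability of being employed: for every $f\in F$, either $\bar x_{f,w}\in\{0,1\}$ for all $w\in W$, or there are exactly $q_f-1$ workers $w$ with $\bar x_{f,w}=1$, exactly two workers $w$ with $0<\bar x_{f,w}<1$, and $\bar x_{f,w}=0$ for all other workers $w$.
   Context: MARKET. $F$ (firms) and $W$ (workers) are finite disjoint sets. Each worker $w$ has a strict linear order $\succ_w$ on $F\cup\{w\}$ ($w$ stands for being unmatched). Each firm $f$ has a quota $q_f$ (a positive integer) and a strict linear order $\succ_f$ on $2^W$; $\boldsymbol q=(q_f)_{f\in F}$; $P$ is the profile of all these preferences. $\succeq$ denotes "$\succ$ or equal". For workers $j,w$ write $j\succ_f w$ for $\{j\}\succ_f\{w\}$. Firms' preferences are $\boldsymbol q$-responsive: (1) $\emptyset\succ_f T$ whenever $|T|>q_f$; (2) if $|T|<q_f$ and $w\notin T$, then $T\cup\{w\}\succ_f T$ iff $\{w\}\succ_f\emptyset$; (3) if $|T|<q_f$ and $w,w'\notin T$, then $T\cup\{w\}\succ_f T\cup\{w'\}$ iff $w\succ_f w'$. A pair $(f,w)$ is acceptable if $\{w\}\succ_f\emptyset$ and $f\succ_w w$;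 $A=A(P)$ is the set of acceptable pairs. STRONG STABILITY. The polytope $CP$ is the set of $x\in\mathbb{R}^{F\times W}$ with $\sum_{j\in W}x_{f,j}\le q_f$ for all $f$; $\sum_{i\in F}x_{i,w}\le 1$ for all $w$; $x_{f,w}\ge0$ for all $(f,w)$; $x_{f,w}=0$ for $(f,w)\notin A$. A strongly stable fractional matching is a (not necessarily integer) point $\bar x\in CP$ such that for every $(f,w)\in A$, $$\Bigl[q_f-\sum_{j\succeq_f w}\bar x_{f,j}\Bigr]\cdot\Bigl[1-\sum_{i\succeq_w f}\bar x_{i,w}\Bigr]=0.$$ Sums over $j$ range over workers, sums over $i$ over firms. The entry $\bar x_{f,w}$ is interpreted as the probability that $f$ and $w$ are matched. *)

theory Defs imports Complex_Main begin

text \<open>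
  Agents live in one type; \<open>F\<close> is the set of firms, \<open>W\<close> the set of workers.
  A strict preference is a relation in which \<open>(a, b)\<close> means that \<open>a\<close> is strictly
  preferred to \<open>b\<close>. The preference \<open>PW w\<close> of a worker \<open>w\<close> ranks \<open>insert w F\<close>, where \<open>w\<close>
  stands for being unmatched; the preference \<open>PF f\<close> of a firm ranks \<open>Pow W\<close>.
\<close>

text \<open>
  The library predicate \<open>strict_linear_order_on\<close> does not confine the relation to the
  carrier, hence the additional inclusion.
\<close>

definition strict_pref_on :: "'b set \<Rightarrow> 'b rel \<Rightarrow> bool" where
  "strict_pref_on X R \<longleftrightarrow> R \<subseteq> X \<times> X \<and> strict_linear_order_on X R"

definition responsive :: "'a set \<Rightarrow> nat \<Rightarrow> 'a set rel \<Rightarrow> bool" where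
  "responsive W k R \<longleftrightarrow>
     (\<forall>T. T \<subseteq> W \<longrightarrow> card T > k \<longrightarrow> ({}, T) \<in> R) \<and>
     (\<forall>T w. T \<subseteq> W \<longrightarrow> card T < k \<longrightarrow> w \<in> W - T \<longrightarrow>
        ((T \<union> {w}, T) \<in> R \<longleftrightarrow> ({w}, {}) \<in> R)) \<and>
     (\<forall>T w w'. T \<subseteq> W \<longrightarrow> card T < k \<longrightarrow> w \<in> W - T \<longrightarrow> w' \<in> W - T \<longrightarrow>
        ((T \<union> {w}, T \<union> {w'}) \<in> R \<longleftrightarrow> ({w}, {w'}) \<in> R))"

locale many_to_one_market =
  fixes F W :: "'a set"
    and PW :: "'a \<Rightarrow> 'a rel"
    and PF :: "'a \<Rightarrow> 'a set rel"
    and q :: "'a \<Rightarrow> nat"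
  assumes finite_firms: "finite F"
    and finite_workers: "finite W"
    and disjoint: "F \<inter> W = {}"
    and worker_pref: "w \<in> W \<Longrightarrow> strict_pref_on (insert w F) (PW w)"
    and firm_pref: "f \<in> F \<Longrightarrow> strict_pref_on (Pow W) (PF f)"
    and quota_pos: "f \<in> F \<Longrightarrow> 0 < q f"
    and firm_responsive: "f \<in> F \<Longrightarrow> responsive W (q f) (PF f)"

definition acceptable_pairs ::
  "'a set \<Rightarrow> 'a set \<Rightarrow> ('a \<Rightarrow> 'a rel) \<Rightarrow> ('a \<Rightarrow> 'a set rel) \<Rightarrow> ('a \<times> 'a) set" where
  "acceptable_pairs F W PW PF =
     {(f, w). f \<in> F \<and> w \<in> W \<and> ({w}, {}) \<in> PF f \<and> (f, w) \<in> PW w}"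

definition firm_weakly_prefers :: "('a \<Rightarrow> 'a set rel) \<Rightarrow> 'a \<Rightarrow> 'a \<Rightarrow> 'a \<Rightarrow> bool" where
  "firm_weakly_prefers PF f j w \<longleftrightarrow> ({j}, {w}) \<in> PF f \<or> j = w"

definition worker_weakly_prefers :: "('a \<Rightarrow> 'a rel) \<Rightarrow> 'a \<Rightarrow> 'a \<Rightarrow> 'a \<Rightarrow> bool" where
  "worker_weakly_prefers PW w i f \<longleftrightarrow> (i, f) \<in> PW w \<or> i = f"

text \<open>
  A point of \<open>\<real>\<^sup>F\<^sup>\<times>\<^sup>W\<close> is a function \<open>x\<close> of which only the values \<open>x f w\<close> with \<open>f \<in> F\<close> and
  \<open>w \<in> W\<close> are relevant.
\<close>

definition CP ::
  "'a set \<Rightarrow> 'a set \<Rightarrow> ('a \<Rightarrow> 'a rel) \<Rightarrow> ('a \<Rightarrow> 'a set rel) \<Rightarrow> ('a \<Rightarrow> nat) \<Rightarrow> ('a \<Rightarrow> 'a \<Rightarrow> real) set"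
  where
  "CP F W PW PF q =
     {x. (\<forall>f\<in>F. (\<Sum>j\<in>W. x f j) \<le> real (q f)) \<and>
         (\<forall>w\<in>W. (\<Sum>i\<in>F. x i w) \<le> 1) \<and>
         (\<forall>f\<in>F. \<forall>w\<in>W. 0 \<le> x f w) \<and>
         (\<forall>f\<in>F. \<forall>w\<in>W. (f, w) \<notin> acceptable_pairs F W PW PF \<longrightarrow> x f w = 0)}"

definition strongly_stable_fractional_matching ::
  "'a set \<Rightarrow> 'a set \<Rightarrow> ('a \<Rightarrow> 'a rel) \<Rightarrow> ('a \<Rightarrow> 'a set rel) \<Rightarrow> ('a \<Rightarrow> nat) \<Rightarrow> ('a \<Rightarrow> 'a \<Rightarrow> real) \<Rightarrow> bool"
  where
  "strongly_stable_fractional_matching F W PW PF q x \<longleftrightarrow>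
     x \<in> CP F W PW PF q \<and>
     (\<forall>(f, w) \<in> acceptable_pairs F W PW PF.
        (real (q f) - (\<Sum>j \<in> {j \<in> W. firm_weakly_prefers PF f j w}. x f j)) *
        (1 - (\<Sum>i \<in> {i \<in> F. worker_weakly_prefers PW w i f}. x i w)) = 0)"

end

theory Submission imports Defs begin

text \<open>
  Call a pair \<open>(f, w)\<close> fractional if \<open>0 < x f w < 1\<close>. By strong stability every fractional pair is
  tight for its firm (the workers \<open>f\<close> weakly prefers to \<open>w\<close> fill the quota, so \<open>w\<close> is the worst
  worker in the support of \<open>f\<close>) or tight for its worker. Hence every agent has at most one tight
  fractional pair. An agent with a tight pair is matched up to an integer capacity and therefore
  belongs to at least two fractional pairs. So at most half of the fractional pairs are tight for
  firms and at most half for workers; as these cover all of them, equality holds throughout: every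
  agent in a fractional pair is filled to capacity and lies in exactly two fractional pairs.
\<close>

section \<open>Double counting over the fibres of a map\<close>

lemma sum_fibres_card:
  fixes g :: "'b \<Rightarrow> 'c"
  assumes "finite E"
  shows "(\<Sum>v\<in>g ` E. card {e \<in> E. g e = v}) = card E"
  using sum.group[of E "g ` E" g "\<lambda>_. 1::nat"] assms by simp

text \<open>Distinct elements of \<open>A\<close> lie in distinct fibres of \<open>g\<close>, and
  each of these disjoint fibres has at least two elements of \<open>E\<close>.\<close>

lemma two_card_le:
  fixes g :: "'b \<Rightarrow> 'c"
  assumes "finite E" "A \<subseteq> E" "inj_on g A"
    and deg: "\<And>e. e \<in> A \<Longrightarrow> 2 \<le> card {e' \<in> E. g e' = g e}"
  shows "2 * card A \<le> card E"
proof -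
  have "2 * card A = (\<Sum>v\<in>g ` A. 2)"
    using card_image[OF assms(3)] by simp
  also have "\<dots> \<le> (\<Sum>v\<in>g ` A. card {e \<in> E. g e = v})"
    by (rule sum_mono) (use deg in auto)
  also have "\<dots> \<le> (\<Sum>v\<in>g ` E. card {e \<in> E. g e = v})"
    by (rule sum_mono2) (use assms in auto)
  finally show ?thesis
    using sum_fibres_card[OF assms(1), of g] by simp
qed

lemma two_card_eq:
  fixes g :: "'b \<Rightarrow> 'c"
  assumes fin: "finite E" and sub: "A \<subseteq> E" and inj: "inj_on g A"
    and deg: "\<And>e. e \<in> A \<Longrightarrow> 2 \<le> card {e' \<in> E. g e' = g e}"
    and eq: "2 * card A = card E" and e: "e \<in> E"
  shows "g e \<in> g ` A" and "card {e' \<in> E. g e' = g e} = 2"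
proof -
  let ?d = "\<lambda>v. card {e \<in> E. g e = v}"
  have fA: "finite (g ` A)"
    using fin sub finite_subset by blast
  have two: "(\<Sum>v\<in>g ` A. 2) = card E"
    using card_image[OF inj] eq by simp
  have le: "(\<Sum>v\<in>g ` A. 2) \<le> (\<Sum>v\<in>g ` A. ?d v)"
    by (rule sum_mono) (use deg in auto)
  have split: "(\<Sum>v\<in>g ` A. ?d v) + (\<Sum>v\<in>g ` E - g ` A. ?d v) = card E"
    using sum.subset_diff[of "g ` A" "g ` E" ?d] sum_fibres_card[OF fin, of g] fin sub
    by (simp add: image_mono)
  have rest: "(\<Sum>v\<in>g ` E - g ` A. ?d v) = 0"
    using two le split by linarith
  show mem: "g e \<in> g ` A"
  proof (rule ccontr)
    assume "g e \<notin> g ` A"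
    then have "?d (g e) \<le> (\<Sum>v\<in>g ` E - g ` A. ?d v)"
      by (intro member_le_sum) (use e fin in auto)
    moreover have "0 < ?d (g e)"
      unfolding card_gt_0_iff using fin e by auto
    ultimately show False
      using rest by linarith
  qed
  have "(\<Sum>v\<in>g ` A. 2) = (\<Sum>v\<in>g ` A. ?d v)"
    using two le split by linarith
  then show "?d (g e) = 2"
    using sum_mono_inv[of "\<lambda>_. 2" "g ` A" ?d "g e"] deg mem fA by auto
qed

section \<open>Tight capacity constraints\<close>

lemma tight_subset_sum:
  fixes y :: "'b \<Rightarrow> real"
  assumes "finite S" "T \<subseteq> S" "\<And>i. i \<in> S \<Longrightarrow> 0 \<le> y i" "sum y S \<le> k" "sum y T = k"
  shows "sum y S = k" and "\<And>i. i \<in> S \<Longrightarrow> 0 < y i \<Longrightarrow> i \<in> T"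
proof -
  have split: "sum y S = sum y (S - T) + sum y T"
    using sum.subset_diff assms by blast
  \<comment> \<open>The mass outside \<open>T\<close> is nonnegative and at most
    \<open>k - k\<close>, hence zero.\<close>
  have nonneg: "0 \<le> sum y (S - T)"
    using assms by (auto intro: sum_nonneg)
  then show "sum y S = k"
    using split assms by linarith
  then have "sum y (S - T) = 0"
    using split assms by linarith
  then have "\<forall>i\<in>S - T. y i = 0"
    using sum_nonneg_eq_0_iff[of "S - T" y] assms by auto
  then show "\<And>i. i \<in> S \<Longrightarrow> 0 < y i \<Longrightarrow> i \<in> T"
    by (metis DiffI less_irrefl)
qed

text \<open>A tight upper set contains the whole support of \<open>y\<close>, so \<open>a\<close>
  and \<open>b\<close> each lie in the upper set of the other. This will show that no agent has two
  tight fractional pairs.\<close>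

lemma tight_upper_set_unique:
  fixes y :: "'b \<Rightarrow> real"
  assumes "finite S" "\<And>i. i \<in> S \<Longrightarrow> 0 \<le> y i" "sum y S \<le> k"
    and "a \<in> S" "0 < y a" "sum y {i \<in> S. r i a \<or> i = a} = k"
    and "b \<in> S" "0 < y b" "sum y {i \<in> S. r i b \<or> i = b} = k"
    and asym: "\<not> (r a b \<and> r b a)"
  shows "a = b"
proof -
  have "b \<in> {i \<in> S. r i a \<or> i = a}"
    by (rule tight_subset_sum(2)[of S _ y k]) (use assms in auto)
  moreover have "a \<in> {i \<in> S. r i b \<or> i = b}"
    by (rule tight_subset_sum(2)[of S _ y k]) (use assms in auto)
  ultimately show ?thesis
    using asym by auto
qed

section \<open>Fractional entries of a vector with integer sum\<close>

lemma sum_ones_plus_fractional: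
  fixes y :: "'b \<Rightarrow> real"
  assumes "finite S" "\<And>i. i \<in> S \<Longrightarrow> 0 \<le> y i \<and> y i \<le> 1"
  shows "sum y S = real (card {i \<in> S. y i = 1}) + sum y {i \<in> S. 0 < y i \<and> y i < 1}"
proof -
  have "sum y S = sum y ({i \<in> S. y i = 1} \<union> {i \<in> S. 0 < y i \<and> y i < 1})"
    by (rule sum.mono_neutral_right) (use assms in \<open>force+\<close>)
  also have "\<dots> = sum y {i \<in> S. y i = 1} + sum y {i \<in> S. 0 < y i \<and> y i < 1}"
    by (rule sum.union_disjoint) (use assms in auto)
  finally show ?thesis
    by simp
qed

text \<open>A single fractional entry would put the sum strictly between two consecutive
  integers.\<close>

lemma two_le_card_fractional:
  fixes y :: "'b \<Rightarrow> real"
  assumes "finite S" "\<And>i. i \<in> S \<Longrightarrow> 0 \<le> y i \<and> y i \<le> 1" "sum y S = real n"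
    and a: "a \<in> S" "0 < y a" "y a < 1"
  shows "2 \<le> card {i \<in> S. 0 < y i \<and> y i < 1}"
proof (rule ccontr)
  let ?D = "{i \<in> S. 0 < y i \<and> y i < 1}"
  assume "\<not> 2 \<le> card ?D"
  moreover have "a \<in> ?D" "finite ?D"
    using a assms(1) by auto
  moreover from this have "card ?D \<noteq> 0"
    by auto
  ultimately have "card ?D = 1"
    by linarith
  then have "?D = {a}"
    using \<open>a \<in> ?D\<close> by (metis card_1_singletonE singletonD)
  then have "real n = real (card {i \<in> S. y i = 1}) + y a"
    using sum_ones_plus_fractional[of S y] assms by simp
  then have "real (card {i \<in> S. y i = 1}) < real n" "real n < real (card {i \<in> S. y i = 1} + 1)"
    using a by simp_all
  then show False
    unfolding of_nat_less_iff by linarith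
qed

text \<open>The two fractional values add up to an integer strictly between 0 and 2, that is, to 1.
  In particular \<open>n\<close> is positive and \<open>n - 1\<close> is not truncated.\<close>

lemma card_ones:
  fixes y :: "'b \<Rightarrow> real"
  assumes "finite S" "\<And>i. i \<in> S \<Longrightarrow> 0 \<le> y i \<and> y i \<le> 1" "sum y S = real n"
    and "card {i \<in> S. 0 < y i \<and> y i < 1} = 2"
  shows "card {i \<in> S. y i = 1} = n - 1"
proof -
  obtain a b where ab: "{i \<in> S. 0 < y i \<and> y i < 1} = {a, b}" "a \<noteq> b"
    using assms(4) by (auto simp: card_2_iff)
  then have "0 < y a" "y a < 1" "0 < y b" "y b < 1"
    by blast+
  moreover have "real n = real (card {i \<in> S. y i = 1}) + (y a + y b)"
    using sum_ones_plus_fractional[of S y] assms ab by simp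
  ultimately show ?thesis
    by linarith
qed

lemma strict_pref_on_asym:
  assumes "strict_pref_on X R"
  shows "\<not> ((a, b) \<in> R \<and> (b, a) \<in> R)"
  using assms unfolding strict_pref_on_def strict_linear_order_on_def
  by (meson irreflD transD)

section \<open>The graph of fractional pairs\<close>

text \<open>These are the edges of a bipartite graph; the fibres of \<open>fst\<close> and
  \<open>snd\<close> give the degrees of firms and workers.\<close>

definition fractional_pairs :: "'a set \<Rightarrow> 'a set \<Rightarrow> ('a \<Rightarrow> 'a \<Rightarrow> real) \<Rightarrow> ('a \<times> 'a) set" where
  "fractional_pairs F W x = {(f, w) \<in> F \<times> W. 0 < x f w \<and> x f w < 1}"

lemma card_fractional_pairs_fst:
  assumes "f \<in> F"
  shows "card {e \<in> fractional_pairs F W x. fst e = f} = card {w \<in> W. 0 < x f w \<and> x f w < 1}"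
proof -
  have "{e \<in> fractional_pairs F W x. fst e = f} = Pair f ` {w \<in> W. 0 < x f w \<and> x f w < 1}"
    using assms by (auto simp: fractional_pairs_def)
  then show ?thesis
    by (simp add: card_image inj_on_def)
qed

lemma card_fractional_pairs_snd:
  assumes "w \<in> W"
  shows "card {e \<in> fractional_pairs F W x. snd e = w} = card {f \<in> F. 0 < x f w \<and> x f w < 1}"
proof -
  have "{e \<in> fractional_pairs F W x. snd e = w} = (\<lambda>f. (f, w)) ` {f \<in> F. 0 < x f w \<and> x f w < 1}"
    using assms by (auto simp: fractional_pairs_def)
  then show ?thesis
    by (simp add: card_image inj_on_def)
qed

lemma CP_bounds:
  assumes "finite F" "x \<in> CP F W PW PF q" "f \<in> F" "w \<in> W"
  shows "0 \<le> x f w \<and> x f w \<le> 1"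
proof -
  have "x f w \<le> (\<Sum>i\<in>F. x i w)"
    by (rule member_le_sum) (use assms in \<open>auto simp: CP_def\<close>)
  then show ?thesis
    using assms by (fastforce simp: CP_def)
qed

text \<open>The double count is run twice, with \<open>fst\<close> on the pairs tight for firms and
  with \<open>snd\<close> on those tight for workers.\<close>

lemma fractional_pairs_degree:
  fixes F W :: "'a set"
  assumes "many_to_one_market F W PW PF q"
    and "strongly_stable_fractional_matching F W PW PF q x"
    and fw: "(f, w) \<in> fractional_pairs F W x"
  shows "card {f \<in> F. 0 < x f w \<and> x f w < 1} = 2"
    and "card {w \<in> W. 0 < x f w \<and> x f w < 1} = 2"
    and "(\<Sum>j\<in>W. x f j) = real (q f)"
proof -
  interpret many_to_one_market F W PW PF q
    by fact
  let ?E = "fractional_pairs F W x"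
  define A where "A = {(f, w) \<in> ?E. (\<Sum>j \<in> {j \<in> W. firm_weakly_prefers PF f j w}. x f j) = real (q f)}"
  define B where "B = {(f, w) \<in> ?E. (\<Sum>i \<in> {i \<in> F. worker_weakly_prefers PW w i f}. x i w) = 1}"
  have CP: "x \<in> CP F W PW PF q"
    using assms(2) by (simp add: strongly_stable_fractional_matching_def)
  note bounds = CP_bounds[OF finite_firms CP]
  have quota: "(\<Sum>j\<in>W. x f j) \<le> real (q f)" if "f \<in> F" for f
    using CP that by (auto simp: CP_def)
  have unit: "(\<Sum>i\<in>F. x i w) \<le> 1" if "w \<in> W" for w
    using CP that by (auto simp: CP_def)
  have finE: "finite ?E"
    by (rule finite_subset[of _ "F \<times> W"])
      (auto simp: fractional_pairs_def finite_firms finite_workers)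
  have AE: "A \<subseteq> ?E" and BE: "B \<subseteq> ?E"
    by (auto simp: A_def B_def)
  \<comment> \<open>A positive entry belongs to an acceptable pair, so one factor of the strong
    stability product vanishes there.\<close>
  have cover: "?E = A \<union> B"
  proof -
    have "e \<in> A \<union> B" if "e \<in> ?E" for e
    proof -
      obtain f w where e: "e = (f, w)" "f \<in> F" "w \<in> W" "0 < x f w"
        using \<open>e \<in> ?E\<close> by (auto simp: fractional_pairs_def)
      then have "(f, w) \<in> acceptable_pairs F W PW PF"
        using CP by (force simp: CP_def)
      then show ?thesis
        using assms(2) \<open>e \<in> ?E\<close> e
        by (fastforce simp: strongly_stable_fractional_matching_def A_def B_def)
    qed
    then show ?thesis
      using AE BE by auto
  qed
  have full_firm: "(\<Sum>j\<in>W. x f j) = real (q f)" if "(f, w) \<in> A" for f w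
    by (rule tight_subset_sum(1)[of W "{j \<in> W. firm_weakly_prefers PF f j w}"])
      (use that bounds quota finite_workers in \<open>auto simp: A_def fractional_pairs_def\<close>)
  have full_worker: "(\<Sum>i\<in>F. x i w) = 1" if "(f, w) \<in> B" for f w
    by (rule tight_subset_sum(1)[of F "{i \<in> F. worker_weakly_prefers PW w i f}"])
      (use that bounds unit finite_firms in \<open>auto simp: B_def fractional_pairs_def\<close>)
  have injA: "inj_on fst A"
  proof -
    have "w = w'" if "(f, w) \<in> A" "(f, w') \<in> A" for f w w'
      by (rule tight_upper_set_unique[of W "x f" "real (q f)" _ "\<lambda>j w. ({j}, {w}) \<in> PF f"])
        (use that bounds quota finite_workers strict_pref_on_asym[OF firm_pref] in
          \<open>auto simp: A_def fractional_pairs_def firm_weakly_prefers_def\<close>)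
    then show ?thesis
      by (auto simp: inj_on_def)
  qed
  have injB: "inj_on snd B"
  proof -
    have "f = f'" if "(f, w) \<in> B" "(f', w) \<in> B" for f f' w
      by (rule tight_upper_set_unique[of F "\<lambda>i. x i w" 1 _ "\<lambda>i f. (i, f) \<in> PW w"])
        (use that bounds unit finite_firms strict_pref_on_asym[OF worker_pref] in
          \<open>auto simp: B_def fractional_pairs_def worker_weakly_prefers_def\<close>)
    then show ?thesis
      by (auto simp: inj_on_def)
  qed
  have degA: "2 \<le> card {e' \<in> ?E. fst e' = fst e}" if "e \<in> A" for e
  proof -
    obtain f w where e: "e = (f, w)" "f \<in> F" "w \<in> W" "0 < x f w" "x f w < 1"
      using subsetD[OF AE \<open>e \<in> A\<close>] by (auto simp: fractional_pairs_def)
    have "2 \<le> card {w \<in> W. 0 < x f w \<and> x f w < 1}"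
      by (rule two_le_card_fractional[of W _ "q f" w])
        (use e \<open>e \<in> A\<close> bounds full_firm finite_workers in auto)
    then show ?thesis
      using e card_fractional_pairs_fst[of f F W x] by simp
  qed
  have degB: "2 \<le> card {e' \<in> ?E. snd e' = snd e}" if "e \<in> B" for e
  proof -
    obtain f w where e: "e = (f, w)" "f \<in> F" "w \<in> W" "0 < x f w" "x f w < 1"
      using subsetD[OF BE \<open>e \<in> B\<close>] by (auto simp: fractional_pairs_def)
    have "2 \<le> card {f \<in> F. 0 < x f w \<and> x f w < 1}"
      by (rule two_le_card_fractional[of F _ 1 f])
        (use e \<open>e \<in> B\<close> bounds full_worker finite_firms in auto)
    then show ?thesis
      using e card_fractional_pairs_snd[of w W F x] by simp
  qed
  \<comment> \<open>\<open>A\<close> and \<open>B\<close> cover \<open>?E\<close>, yet each has at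
    most half its size, so both have exactly half.\<close>
  have "card ?E \<le> card A + card B"
    using cover card_Un_le[of A B] by simp
  moreover have "2 * card A \<le> card ?E"
    using two_card_le[OF finE AE injA degA] .
  moreover have "2 * card B \<le> card ?E"
    using two_card_le[OF finE BE injB degB] .
  ultimately have eqA: "2 * card A = card ?E" and eqB: "2 * card B = card ?E"
    by linarith+
  have mem: "f \<in> F" "w \<in> W"
    using fw by (auto simp: fractional_pairs_def)
  show "card {w \<in> W. 0 < x f w \<and> x f w < 1} = 2"
    using two_card_eq(2)[OF finE AE injA degA eqA fw] card_fractional_pairs_fst mem
    by fastforce
  show "card {f \<in> F. 0 < x f w \<and> x f w < 1} = 2"
    using two_card_eq(2)[OF finE BE injB degB eqB fw] card_fractional_pairs_snd mem
    by fastforce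
  \<comment> \<open>The given pair may be tight only for its worker, but \<open>f\<close> then has
    some other pair in \<open>A\<close>, which fills its quota.\<close>
  show "(\<Sum>j\<in>W. x f j) = real (q f)"
    using two_card_eq(1)[OF finE AE injA degA eqA fw] full_firm by auto
qed

theorem corollary3:
  fixes F W :: "'a set"
    and PW :: "'a \<Rightarrow> 'a rel"
    and PF :: "'a \<Rightarrow> 'a set rel"
    and q :: "'a \<Rightarrow> nat"
    and x :: "'a \<Rightarrow> 'a \<Rightarrow> real"
  assumes "many_to_one_market F W PW PF q"
    and "strongly_stable_fractional_matching F W PW PF q x"
  shows "(\<forall>w\<in>W. card {f \<in> F. x f w > 0} \<le> 2) \<and>
    (\<forall>f\<in>F. (\<forall>w\<in>W. x f w \<in> {0, 1}) \<or>
       (card {w \<in> W. x f w = 1} = q f - 1 \<and>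
        card {w \<in> W. 0 < x f w \<and> x f w < 1} = 2 \<and>
        (\<forall>w\<in>W. x f w \<noteq> 1 \<and> \<not> (0 < x f w \<and> x f w < 1) \<longrightarrow> x f w = 0)))"
proof (intro conjI ballI)
  interpret many_to_one_market F W PW PF q
    by fact
  have CP: "x \<in> CP F W PW PF q"
    using assms(2) by (simp add: strongly_stable_fractional_matching_def)
  note bounds = CP_bounds[OF finite_firms CP]
  note degree = fractional_pairs_degree[OF assms]
  show "card {f \<in> F. x f w > 0} \<le> 2" if w: "w \<in> W" for w
  proof (cases "\<exists>f\<in>F. x f w = 1")
    case True
    then obtain f where f: "f \<in> F" "x f w = 1"
      by blast
    \<comment> \<open>The entry 1 alone exhausts the unit capacity of \<open>w\<close>.\<close>
    have "{i \<in> F. x i w > 0} \<subseteq> {f}"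
    proof
      fix i assume i: "i \<in> {i \<in> F. x i w > 0}"
      have "i \<in> {f}"
        by (rule tight_subset_sum(2)[of F "{f}" "\<lambda>i. x i w" 1])
          (use i f w bounds CP finite_firms in \<open>auto simp: CP_def\<close>)
      then show "i \<in> {f}" .
    qed
    then have "card {i \<in> F. x i w > 0} \<le> card {f}"
      by (intro card_mono) auto
    then show ?thesis
      by simp
  next
    case False
    \<comment> \<open>Without an entry 1 every positive entry is fractional, so the support of
      \<open>w\<close> is empty or has exactly two firms.\<close>
    then have eq: "{f \<in> F. x f w > 0} = {f \<in> F. 0 < x f w \<and> x f w < 1}"
      using bounds w by force
    show ?thesis
    proof (cases "{f \<in> F. x f w > 0} = {}")
      case True
      then show ?thesis
        by (metis card.empty zero_le)
    next
      case False
      then obtain f where "(f, w) \<in> fractional_pairs F W x"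
        using eq w by (auto simp: fractional_pairs_def)
      then show ?thesis
        using degree(1) eq by simp
    qed
  qed
  show "(\<forall>w\<in>W. x f w \<in> {0, 1}) \<or>
       (card {w \<in> W. x f w = 1} = q f - 1 \<and>
        card {w \<in> W. 0 < x f w \<and> x f w < 1} = 2 \<and>
        (\<forall>w\<in>W. x f w \<noteq> 1 \<and> \<not> (0 < x f w \<and> x f w < 1) \<longrightarrow> x f w = 0))" if f: "f \<in> F" for f
  proof (cases "\<forall>w\<in>W. x f w \<in> {0, 1}")
    case False
    \<comment> \<open>One fractional entry suffices: it forces a full quota and exactly two
      fractional workers, which fixes the number of ones.\<close>
    then obtain w where "(f, w) \<in> fractional_pairs F W x"
      using f bounds by (force simp: fractional_pairs_def)
    note deg = degree(2,3)[OF this]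
    have "card {w \<in> W. x f w = 1} = q f - 1"
      by (rule card_ones) (use f bounds deg finite_workers in auto)
    then show ?thesis
      using deg f bounds by force
  qed simp
qed

end
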